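(* Let $m,n\ge 1$ be integers. Positive semidefiniteness of matrices in $\mathcal{Q}(m)\otimes\mathcal{S}(n)$ is preserved by matrix transposition (i.e. for every positive semidefinite $A\in\mathcal{Q}(m)\otimes\mathcal{S}(n)$ the transpose $A^T$ is positive semidefinite) if and only if $m=1$ ($n$ arbitrary), or $m=2$ and $n\le 2$.
   Context: $\mathcal{S}(n)$ is the real vector space of real symmetric $n\times n$ matrices. $\mathcal{Q}(m)$ is the real vector space of quaternionic hermitian $m\times m$ matrices ($A=A^*$, with $*$ the quaternionic conjugate transpose). A matrix $A\in\mathcal{Q}(N)$ is positive semidefinite if $v^*Av\ge 0$ for all $v\in\mathbb{H}^N$. The (real) tensor product $\mathcal{Q}(m)\otimes\mathcal{S}(n)$ is regarded as a subspace of $\mathcal{Q}(mn)$ via the Kronecker product ($m\times m$ blocks of size $n\times n$, $A\otimes B=(a_{\alpha\beta}B)$). The transpose $A^T$ (without conjugation) of a quaternionic hermitian matrix equals its entrywise quaternionic conjugate $\overline{A}$ and is again hermitian. *)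

theory Defs
  imports "HOL-Analysis.Analysis"
begin

datatype quat = Quat (qRe: real) (qI: real) (qJ: real) (qK: real)

lemma quat_eq_iff:
  "p = q \<longleftrightarrow> qRe p = qRe q \<and> qI p = qI q \<and> qJ p = qJ q \<and> qK p = qK q"
  by (cases p; cases q) simp

instantiation quat :: real_algebra_1
begin

definition zero_quat :: quat where "0 = Quat 0 0 0 0"

definition one_quat :: quat where "1 = Quat 1 0 0 0"

definition plus_quat :: "quat \<Rightarrow> quat \<Rightarrow> quat" where
  "p + q = Quat (qRe p + qRe q) (qI p + qI q) (qJ p + qJ q) (qK p + qK q)"

definition uminus_quat :: "quat \<Rightarrow> quat" where
  "- p = Quat (- qRe p) (- qI p) (- qJ p) (- qK p)"

definition minus_quat :: "quat \<Rightarrow> quat \<Rightarrow> quat" where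
  "p - q = Quat (qRe p - qRe q) (qI p - qI q) (qJ p - qJ q) (qK p - qK q)"

definition scaleR_quat :: "real \<Rightarrow> quat \<Rightarrow> quat" where
  "r *\<^sub>R p = Quat (r * qRe p) (r * qI p) (r * qJ p) (r * qK p)"

definition times_quat :: "quat \<Rightarrow> quat \<Rightarrow> quat" where
  "p * q = Quat
     (qRe p * qRe q - qI p * qI q - qJ p * qJ q - qK p * qK q)
     (qRe p * qI q + qI p * qRe q + qJ p * qK q - qK p * qJ q)
     (qRe p * qJ q - qI p * qK q + qJ p * qRe q + qK p * qI q)
     (qRe p * qK q + qI p * qJ q - qJ p * qI q + qK p * qRe q)"

instance
  by standard
    (simp_all add: quat_eq_iff zero_quat_def one_quat_def plus_quat_def uminus_quat_def
      minus_quat_def scaleR_quat_def times_quat_def algebra_simps)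

end

lemma hamilton_relations:
  "Quat 0 1 0 0 * Quat 0 1 0 0 = - 1" "Quat 0 0 1 0 * Quat 0 0 1 0 = - 1"
  "Quat 0 0 0 1 * Quat 0 0 0 1 = - 1"
  "Quat 0 1 0 0 * Quat 0 0 1 0 = Quat 0 0 0 1"
  "Quat 0 0 1 0 * Quat 0 0 0 1 = Quat 0 1 0 0"
  "Quat 0 0 0 1 * Quat 0 1 0 0 = Quat 0 0 1 0"
  by (simp_all add: quat_eq_iff times_quat_def uminus_quat_def one_quat_def)

definition qcnj :: "quat \<Rightarrow> quat" where
  "qcnj q = Quat (qRe q) (- qI q) (- qJ q) (- qK q)"

definition qadjoint :: "quat^'n^'m \<Rightarrow> quat^'m^'n" where
  "qadjoint A = (\<chi> i j. qcnj (A $ j $ i))"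

definition sym_mats :: "(real^'n^'n) set" where
  "sym_mats = {B. transpose B = B}"

definition qherm_mats :: "(quat^'n^'n) set" where
  "qherm_mats = {A. qadjoint A = A}"

text \<open>The inequality \<open>v\<^sup>* A v \<ge> 0\<close> between quaternions means that the left-hand side is a
  nonnegative real number.\<close>

definition qpsd :: "quat^'n^'n \<Rightarrow> bool" where
  "qpsd A \<longleftrightarrow> A \<in> qherm_mats \<and>
     (\<forall>v. \<exists>r\<ge>0. (\<Sum>i\<in>UNIV. qcnj (v $ i) * (A *v v) $ i) = of_real r)"

text \<open>Rows and columns of an \<open>mn \<times> mn\<close> matrix are indexed by pairs \<open>(\<alpha>, i)\<close>, where \<open>\<alpha>\<close>
  selects one of the \<open>m\<close> blocks and \<open>i\<close> a position inside a block of size \<open>n\<close>.\<close>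

definition kronecker :: "quat^'m^'m \<Rightarrow> real^'n^'n \<Rightarrow> quat^('m \<times> 'n)^('m \<times> 'n)" where
  "kronecker A B = (\<chi> p q. A $ fst p $ fst q * of_real (B $ snd p $ snd q))"

definition tensor_QS :: "(quat^('m::finite \<times> 'n::finite)^('m \<times> 'n)) set" where
  "tensor_QS = span {kronecker A B | A B. A \<in> qherm_mats \<and> B \<in> sym_mats}"

lemma subspace_qherm_mats: "subspace (qherm_mats :: (quat^'n^'n) set)"
  unfolding subspace_def qherm_mats_def qadjoint_def
  by (auto simp: vec_eq_iff qcnj_def quat_eq_iff zero_quat_def plus_quat_def scaleR_quat_def
      simp flip: mult_minus_right)

lemma kronecker_in_qherm_mats:
  assumes "A \<in> qherm_mats" and "B \<in> sym_mats"
  shows "kronecker A B \<in> qherm_mats"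
  using assms
  by (simp add: qherm_mats_def sym_mats_def qadjoint_def transpose_def kronecker_def vec_eq_iff
      qcnj_def quat_eq_iff times_quat_def of_real_def scaleR_quat_def one_quat_def
      flip: mult_minus_left)

lemma tensor_QS_subset_qherm_mats: "tensor_QS \<subseteq> qherm_mats"
  unfolding tensor_QS_def
  by (rule span_minimal) (auto intro: kronecker_in_qherm_mats subspace_qherm_mats)

end

(*
  A matrix in the tensor product is a hermitian matrix whose (i, j) and (j, i) entries agree inside
  every block. For m = 1 it is therefore real symmetric. For m = 2 and n <= 2 the entries of the
  off-diagonal block span at most three dimensions of the four-dimensional real space of
  quaternions, so there is a unit quaternion t orthogonal to all of them. Then q* = - t* q t* for
  each such entry q, which says that the transpose of A is D A D* with D = diag(t*, -t).

  For m >= 3 take A = g g* with g = (1, i, j). For m = 2 and n >= 3 take the block matrix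
  [[I, Q], [Q*, R]] with Q = [[0, 1, i], [1, 0, j], [i, j, k]] and R real: its positivity means
  R >= Q* Q, that of its transpose R >= Q Q*. The imaginary parts of Q* Q and Q Q* have different
  supports, and R = diag(7, 3, 4) separates them.
*)

theory Submission
  imports Defs
begin

section \<open>Quaternionic conjugation and Gram matrices\<close>

lemmas quat_defs = zero_quat_def one_quat_def plus_quat_def uminus_quat_def minus_quat_def
  scaleR_quat_def times_quat_def of_real_def qcnj_def

lemma qcnj_add [simp]: "qcnj (p + q) = qcnj p + qcnj q"
  and qcnj_uminus [simp]: "qcnj (- p) = - qcnj p"
  and qcnj_mult [simp]: "qcnj (p * q) = qcnj q * qcnj p"
  and qcnj_qcnj [simp]: "qcnj (qcnj p) = p"
  and qcnj_zero [simp]: "qcnj 0 = 0"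
  and qcnj_one [simp]: "qcnj 1 = 1"
  and qcnj_of_real [simp]: "qcnj (of_real r) = of_real r"
  by (simp_all add: quat_eq_iff quat_defs algebra_simps)

lemma qcnj_sum: "qcnj (sum f S) = (\<Sum>x\<in>S. qcnj (f x))"
  by (induction S rule: infinite_finite_induct) simp_all

lemma qcnj_mult_self: "qcnj q * q = of_real ((qRe q)\<^sup>2 + (qI q)\<^sup>2 + (qJ q)\<^sup>2 + (qK q)\<^sup>2)"
  by (simp add: quat_eq_iff quat_defs power2_eq_square)

lemma qRe_of_real [simp]: "qRe (of_real r) = r"
  by (simp add: quat_defs)

lemma qcnj_eq_self_iff: "qcnj q = q \<longleftrightarrow> q = of_real (qRe q)"
  by (auto simp: quat_eq_iff quat_defs)

lemma of_real_commute_quat: "of_real r * (q :: quat) = q * of_real r"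
  by (simp add: of_real_def)

lemma qherm_mats_iff: "A \<in> qherm_mats \<longleftrightarrow> (\<forall>p q. qcnj (A $ q $ p) = A $ p $ q)"
  by (auto simp: qherm_mats_def qadjoint_def vec_eq_iff)

lemma qherm_transpose: "A \<in> qherm_mats \<Longrightarrow> transpose A \<in> qherm_mats"
  by (simp add: qherm_mats_iff transpose_def)

definition qform :: "quat^'n^'n \<Rightarrow> quat^'n \<Rightarrow> quat" where
  "qform A v = (\<Sum>p\<in>UNIV. \<Sum>q\<in>UNIV. qcnj (v $ p) * A $ p $ q * v $ q)"

lemma qpsd_iff: "qpsd A \<longleftrightarrow> A \<in> qherm_mats \<and> (\<forall>v. \<exists>r\<ge>0. qform A v = of_real r)"
  by (simp add: qpsd_def qform_def matrix_vector_mult_def sum_distrib_left mult.assoc)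

text \<open>Here A is the sum of the rank-one matrices \<open>g k\<close> (\<open>g k\<close>)*, so
  v* A v is the sum over k of qcnj(y_k) y_k = |y_k|^2, where y_k = (\<open>g k\<close>)* v.\<close>

lemma qpsd_gram:
  fixes A :: "quat^'n^'n" and g :: "nat \<Rightarrow> 'n \<Rightarrow> quat"
  assumes "\<And>p q. A $ p $ q = (\<Sum>k<N. g k p * qcnj (g k q))"
  shows "qpsd A"
  unfolding qpsd_iff
proof (intro conjI allI)
  show "A \<in> qherm_mats"
    by (simp add: qherm_mats_iff assms qcnj_sum)
next
  fix v :: "quat^'n"
  define y where "y k = (\<Sum>q\<in>UNIV. qcnj (g k q) * v $ q)" for k
  have "qform A v = (\<Sum>p\<in>UNIV. \<Sum>q\<in>UNIV. \<Sum>k<N. (qcnj (v $ p) * g k p) * (qcnj (g k q) * v $ q))"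
    by (simp add: qform_def assms sum_distrib_left sum_distrib_right mult.assoc)
  also have "\<dots> = (\<Sum>p\<in>UNIV. \<Sum>k<N. \<Sum>q\<in>UNIV. (qcnj (v $ p) * g k p) * (qcnj (g k q) * v $ q))"
    by (rule sum.cong[OF refl], rule sum.swap)
  also have "\<dots> = (\<Sum>k<N. \<Sum>p\<in>UNIV. \<Sum>q\<in>UNIV. (qcnj (v $ p) * g k p) * (qcnj (g k q) * v $ q))"
    by (rule sum.swap)
  also have "\<dots> = (\<Sum>k<N. qcnj (y k) * y k)"
    by (simp add: y_def qcnj_sum sum_product)
  also have "\<dots> = of_real (\<Sum>k<N. (qRe (y k))\<^sup>2 + (qI (y k))\<^sup>2 + (qJ (y k))\<^sup>2 + (qK (y k))\<^sup>2)"
    by (simp add: qcnj_mult_self)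
  finally show "\<exists>r\<ge>0. qform A v = of_real r"
    by (intro exI conjI[rotated]) (assumption, simp only: sum_nonneg add_nonneg_nonneg zero_le_power2)
qed

section \<open>The tensor product as a symmetry condition on entries\<close>

lemma tensor_QS_imp_swap:
  fixes A :: "quat^('m::finite \<times> 'n::finite)^('m \<times> 'n)"
  assumes "A \<in> tensor_QS"
  shows "A $ (a, i) $ (b, j) = A $ (a, j) $ (b, i)"
proof -
  have "tensor_QS \<subseteq> {A :: quat^('m \<times> 'n)^('m \<times> 'n). \<forall>a b i j. A $ (a, i) $ (b, j) = A $ (a, j) $ (b, i)}"
    unfolding tensor_QS_def
    \<comment> \<open>The condition is linear in the matrix, and on a generator it expresses the
      symmetry of \<open>B\<close>.\<close>
    by (rule span_minimal)
      (auto simp: kronecker_def sym_mats_def transpose_def vec_eq_iff subspace_def)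
  with assms show ?thesis by blast
qed

lemma swap_imp_tensor_QS:
  fixes A :: "quat^('m::finite \<times> 'n::finite)^('m \<times> 'n)"
  assumes herm: "A \<in> qherm_mats"
    and swap: "\<And>a b i j. A $ (a, i) $ (b, j) = A $ (a, j) $ (b, i)"
  shows "A \<in> tensor_QS"
proof -
  define X :: "'n \<Rightarrow> 'n \<Rightarrow> quat^'m^'m" where "X i j = (\<chi> a b. A $ (a, i) $ (b, j))" for i j
  \<comment> \<open>Symmetrised matrix units. The sum below runs over ordered pairs, so position (k,
    l) is reached from (k, l) and from (l, k); each contributes one half, and \<open>swap\<close>
    makes the two halves equal.\<close>
  define E :: "'n \<Rightarrow> 'n \<Rightarrow> real^'n^'n" where
    "E i j = (\<chi> k l. (of_bool (k = i \<and> l = j) + of_bool (k = j \<and> l = i)) / 2)" for i j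
  \<comment> \<open>Hermitian symmetry of \<open>A\<close> exchanges i and j along with the block
    indices; \<open>swap\<close> exchanges them back.\<close>
  have X: "X i j \<in> qherm_mats" for i j
    using herm swap by (simp add: X_def qherm_mats_iff)
  have E: "E i j \<in> sym_mats" for i j
    by (simp add: E_def sym_mats_def transpose_def vec_eq_iff conj_commute add.commute)
  have half: "q * of_real (1 / 2) + q * of_real (1 / 2) = q" for q :: quat
    by (simp add: quat_eq_iff quat_defs)
  have "A $ (a, k) $ (b, l) = (\<Sum>i\<in>UNIV. \<Sum>j\<in>UNIV. kronecker (X i j) (E i j)) $ (a, k) $ (b, l)"
    for a k b l
  proof -
    have "(\<Sum>i\<in>UNIV. \<Sum>j\<in>UNIV. kronecker (X i j) (E i j)) $ (a, k) $ (b, l)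
      = (\<Sum>i\<in>UNIV. \<Sum>j\<in>UNIV. (if j = l then if i = k then A $ (a, i) $ (b, j) * of_real (1/2) else 0 else 0)
          + (if j = k then if i = l then A $ (a, i) $ (b, j) * of_real (1/2) else 0 else 0))"
      by (auto simp: kronecker_def X_def E_def half intro!: sum.cong)
    also have "\<dots> = A $ (a, k) $ (b, l) * of_real (1/2) + A $ (a, l) $ (b, k) * of_real (1/2)"
      by (simp add: sum.distrib)
    also have "\<dots> = A $ (a, k) $ (b, l)"
      using swap[of a k b l] by (simp only: half)
    finally show ?thesis by simp
  qed
  hence "A = (\<Sum>i\<in>UNIV. \<Sum>j\<in>UNIV. kronecker (X i j) (E i j))"
    by (simp add: vec_eq_iff)
  also have "\<dots> \<in> tensor_QS"
    unfolding tensor_QS_def using X E by (intro span_sum span_base) blast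
  finally show ?thesis .
qed

section \<open>Positive cases: congruence by a diagonal of quaternions\<close>

lemma qpsd_transpose_if_congruent:
  fixes A :: "quat^'n^'n" and d :: "'n \<Rightarrow> quat"
  assumes "qpsd A" and d: "\<And>p q. A $ q $ p = d p * A $ p $ q * qcnj (d q)"
  shows "qpsd (transpose A)"
  unfolding qpsd_iff
proof (intro conjI allI)
  show "transpose A \<in> qherm_mats"
    using assms(1) by (simp add: qpsd_iff qherm_transpose)
next
  fix v :: "quat^'n"
  \<comment> \<open>The transpose is D A D* with D = diag(\<open>d\<close>), so its form at v is the
    form of A at D* v.\<close>
  have "qform (transpose A) v = qform A (\<chi> p. qcnj (d p) * v $ p)"
    unfolding qform_def transpose_def
    by (intro sum.cong refl) (simp add: mult.assoc, metis d mult.assoc)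
  with assms(1) show "\<exists>r\<ge>0. qform (transpose A) v = of_real r"
    by (simp add: qpsd_iff)
qed

text \<open>\<open>qRe (t * qcnj q)\<close> is the Euclidean inner product of R^4. Three vectors
  span a proper subspace there, and a nonzero vector orthogonal to it is normalised to
  \<open>t\<close>.\<close>

lemma unit_quat_orthogonal_to_three:
  "\<exists>t. qcnj t * t = 1 \<and> t * qcnj t = 1 \<and> (\<forall>q\<in>{q1, q2, q3}. qRe (t * qcnj q) = 0)"
proof -
  define f :: "quat \<Rightarrow> real \<times> real \<times> real \<times> real" where "f q = (qRe q, qI q, qJ q, qK q)" for q
  have "dim {f q1, f q2, f q3} \<le> card {f q1, f q2, f q3}"
    by (rule dim_le_card') simp
  also have "\<dots> \<le> 3"
    by (simp add: card_insert_if)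
  also have "\<dots> < DIM(real \<times> real \<times> real \<times> real)" by simp
  finally obtain x where x: "x \<noteq> 0" "\<And>y. y \<in> span {f q1, f q2, f q3} \<Longrightarrow> orthogonal x y"
    using orthogonal_to_subspace_exists by blast
  obtain a b c d where abcd: "x = (a, b, c, d)" by (cases x) auto
  define s where "s = sqrt (a\<^sup>2 + b\<^sup>2 + c\<^sup>2 + d\<^sup>2)"
  have "a\<^sup>2 + b\<^sup>2 + c\<^sup>2 + d\<^sup>2 > 0"
    using x(1) unfolding abcd by (auto simp: zero_prod_def less_le power2_eq_square add_nonneg_eq_0_iff)
  hence s: "s \<noteq> 0" "s * s = a\<^sup>2 + b\<^sup>2 + c\<^sup>2 + d\<^sup>2"
    by (simp_all add: s_def)
  define t where "t = Quat (a/s) (b/s) (c/s) (d/s)"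
  have "(a * a + b * b + c * c + d * d) / (s * s) = 1"
    using s by (metis power2_eq_square divide_self mult_eq_0_iff)
  hence n: "qcnj t * t = 1" "t * qcnj t = 1"
    by (simp_all add: t_def quat_eq_iff quat_defs add_divide_distrib)
  have "qRe (t * qcnj q) = 0" if "q \<in> {q1, q2, q3}" for q
  proof -
    have "orthogonal x (f q)" using that by (intro x(2) span_base) blast
    hence "a * qRe q + b * qI q + c * qJ q + d * qK q = 0"
      by (simp add: abcd f_def orthogonal_def)
    moreover have "qRe (t * qcnj q) = (a * qRe q + b * qI q + c * qJ q + d * qK q) / s"
      by (simp add: t_def quat_defs add_divide_distrib)
    ultimately show ?thesis by simp
  qed
  with n show ?thesis by blast
qed

text \<open>A quaternion with zero real part is negated by conjugation, hence t q* = - q t*;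
  multiplying by t* on the left isolates q*.\<close>

lemma orthogonal_quat_reflection:
  assumes "qcnj t * t = 1" "qRe (t * qcnj q) = 0"
  shows "qcnj q = qcnj t * q * (- qcnj t)"
proof -
  have "t * qcnj q + qcnj (t * qcnj q) = 0"
    using assms(2) by (simp only: quat_eq_iff) (simp add: quat_defs)
  hence "q * (- qcnj t) = t * qcnj q"
    by (simp add: neg_eq_iff_add_eq_0 add.commute)
  hence "qcnj t * q * (- qcnj t) = qcnj t * t * qcnj q"
    by (metis mult.assoc)
  with assms(1) show ?thesis by simp
qed

lemma card_le_2_obtain:
  assumes "CARD('n::finite) \<le> 2"
  obtains x y :: "'n::finite" where "UNIV = {x, y}"
proof -
  have "CARD('n) = 1 \<or> CARD('n) = 2" using assms by (metis One_nat_def Suc_1 le_Suc_eq le_zero_eq zero_less_card_finite less_irrefl)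
  thus ?thesis
    using that by (metis card_1_singletonE card_2_iff insert_absorb2)
qed

lemma qpsd_transpose_2_2:
  fixes A :: "quat^('m::finite \<times> 'n::finite)^('m \<times> 'n)"
  assumes "CARD('m) = 2" "CARD('n) \<le> 2" and A: "A \<in> tensor_QS" and psd: "qpsd A"
  shows "qpsd (transpose A)"
proof -
  obtain a b :: 'm where ab: "a \<noteq> b" "UNIV = {a, b}"
    using assms(1) by (metis card_2_iff)
  \<comment> \<open>The case x = y is allowed; it covers n = 1.\<close>
  obtain x y :: 'n where xy: "UNIV = {x, y}"
    using card_le_2_obtain[OF assms(2)] .
  have swap: "A $ (c, i) $ (d, j) = A $ (c, j) $ (d, i)" for c d i j
    using A by (rule tensor_QS_imp_swap)
  have herm: "qcnj (A $ p $ q) = A $ q $ p" for p q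
    using psd unfolding qpsd_iff qherm_mats_iff by blast
  obtain t where t: "qcnj t * t = 1" "t * qcnj t = 1"
    and orth: "\<forall>q\<in>{A $ (a, x) $ (b, x), A $ (a, x) $ (b, y), A $ (a, y) $ (b, y)}. qRe (t * qcnj q) = 0"
    using unit_quat_orthogonal_to_three by blast
  \<comment> \<open>The remaining entry, at positions y and x, equals the one at x and y by
    \<open>swap\<close>.\<close>
  have ortho: "qRe (t * qcnj (A $ (a, i) $ (b, j))) = 0" for i j
    using UNIV_I[of i, unfolded xy] UNIV_I[of j, unfolded xy] orth swap[of a y b x] by auto
  define e where "e c = (if c = a then qcnj t else - t)" for c
  \<comment> \<open>In a diagonal block, hermitian symmetry and \<open>swap\<close> make each entry
    self-conjugate, so real; it commutes with the unit quaternion \<open>e c\<close>, which then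
    cancels.\<close>
  have real: "A $ (c, j) $ (c, i) = e c * A $ (c, i) $ (c, j) * qcnj (e c)" for c i j
  proof -
    have "qcnj (A $ (c, i) $ (c, j)) = A $ (c, i) $ (c, j)"
      using herm swap by metis
    then obtain r where r: "A $ (c, i) $ (c, j) = of_real r"
      by (metis qcnj_eq_self_iff)
    moreover have "e c * qcnj (e c) = 1"
      using t by (simp add: e_def)
    ultimately show ?thesis
      using swap[of c i c j] by (simp add: of_real_commute_quat[symmetric] mult.assoc)
  qed
  have ab': "A $ (b, j) $ (a, i) = e a * A $ (a, i) $ (b, j) * qcnj (e b)" for i j
    using orthogonal_quat_reflection[OF t(1) ortho, of i j] ab(1)
    by (simp add: e_def herm)
  have ba: "A $ (a, j) $ (b, i) = e b * A $ (b, i) $ (a, j) * qcnj (e a)" for i j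
    using arg_cong[OF ab'[of i j], of qcnj] by (simp add: herm mult.assoc)
  have rel: "A $ (d, j) $ (c, i) = e c * A $ (c, i) $ (d, j) * qcnj (e d)" for c d i j
    using UNIV_I[of c, unfolded ab(2)] UNIV_I[of d, unfolded ab(2)] real ab' ba by blast
  show ?thesis
  proof (rule qpsd_transpose_if_congruent[OF psd])
    show "A $ q $ p = e (fst p) * A $ p $ q * qcnj (e (fst q))" for p q
      using rel[of "fst q" "snd q" "fst p" "snd p"] by simp
  qed
qed

lemma transpose_eq_self_1:
  fixes A :: "quat^('m::finite \<times> 'n::finite)^('m \<times> 'n)"
  assumes "CARD('m) = 1" and "A \<in> tensor_QS"
  shows "transpose A = A"
proof -
  have "c = d" for c d :: 'm
    using assms(1) by (metis UNIV_I card_1_singletonE singletonD)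
  thus ?thesis
    using tensor_QS_imp_swap[OF assms(2)] by (auto simp: transpose_def vec_eq_iff) metis
qed

section \<open>Counterexamples from finite tables of quaternions\<close>

lemma sum_bij_truncate:
  fixes f :: "nat \<Rightarrow> quat"
  assumes "bij_betw c UNIV {..<CARD('m)}" "M \<le> CARD('m)" "\<And>a. a \<ge> M \<Longrightarrow> f a = 0"
  shows "(\<Sum>x\<in>(UNIV :: 'm::finite set). f (c x)) = (\<Sum>a<M. f a)"
proof -
  have "(\<Sum>x\<in>(UNIV :: 'm set). f (c x)) = (\<Sum>a<CARD('m). f a)"
    by (rule sum.reindex_bij_betw[OF assms(1)])
  also have "\<dots> = (\<Sum>a<M. f a)"
    using assms(2,3) by (intro sum.mono_neutral_right) auto
  finally show ?thesis .
qed

text \<open>Transfers a computation with natural-number indices to arbitrary finite index types that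
  are large enough. \<open>F\<close> is a Gram matrix, hence positive, and \<open>V\<close> is a
  test vector padded with zeros. In \<open>neg\<close> the index pairs of \<open>F\<close> are
  exchanged: the sum is the form of the transpose.\<close>

lemma counterexample_from_coordinates:
  fixes G :: "nat \<Rightarrow> nat \<Rightarrow> nat \<Rightarrow> quat" and V :: "nat \<Rightarrow> nat \<Rightarrow> quat"
  assumes M: "M \<le> CARD('m::finite)" and L: "L \<le> CARD('n::finite)"
    and F: "\<And>a i b j. F a i b j = (\<Sum>k<N. G k a i * qcnj (G k b j))"
    and swap: "\<And>a i b j. F a i b j = F a j b i"
    and V: "\<And>a i. a \<ge> M \<or> i \<ge> L \<Longrightarrow> V a i = 0"
    and neg: "qRe (\<Sum>a<M. \<Sum>i<L. \<Sum>b<M. \<Sum>j<L. qcnj (V a i) * F b j a i * V b j) < 0"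
  shows "\<exists>A :: quat^('m \<times> 'n)^('m \<times> 'n). A \<in> tensor_QS \<and> qpsd A \<and> \<not> qpsd (transpose A)"
proof -
  obtain c :: "'m \<Rightarrow> nat" where c: "bij_betw c UNIV {..<CARD('m)}"
    using ex_bij_betw_finite_nat[of "UNIV :: 'm set"] by (auto simp: atLeast0LessThan)
  obtain d :: "'n \<Rightarrow> nat" where d: "bij_betw d UNIV {..<CARD('n)}"
    using ex_bij_betw_finite_nat[of "UNIV :: 'n set"] by (auto simp: atLeast0LessThan)
  have sum2: "(\<Sum>p\<in>(UNIV :: ('m \<times> 'n) set). f (c (fst p)) (d (snd p))) = (\<Sum>a<M. \<Sum>i<L. f a i)"
    if "\<And>a i. a \<ge> M \<or> i \<ge> L \<Longrightarrow> f a i = 0" for f :: "nat \<Rightarrow> nat \<Rightarrow> quat"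
  proof -
    have "(\<Sum>p\<in>(UNIV :: ('m \<times> 'n) set). f (c (fst p)) (d (snd p)))
      = (\<Sum>x\<in>UNIV. \<Sum>y\<in>UNIV. f (c x) (d y))"
      unfolding UNIV_Times_UNIV[symmetric] sum.cartesian_product by (simp add: case_prod_unfold)
    also have "\<dots> = (\<Sum>x\<in>UNIV. \<Sum>i<L. f (c x) i)"
      using that by (intro sum.cong[OF refl] sum_bij_truncate[OF d L]) blast
    also have "\<dots> = (\<Sum>a<M. \<Sum>i<L. f a i)"
      using that by (intro sum_bij_truncate[OF c M]) simp
    finally show ?thesis .
  qed
  define A :: "quat^('m \<times> 'n)^('m \<times> 'n)" where
    "A = (\<chi> p q. F (c (fst p)) (d (snd p)) (c (fst q)) (d (snd q)))"
  define v :: "quat^('m \<times> 'n)" where "v = (\<chi> p. V (c (fst p)) (d (snd p)))"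
  have psd: "qpsd A"
    by (rule qpsd_gram[where g = "\<lambda>k p. G k (c (fst p)) (d (snd p))"]) (simp add: A_def F)
  hence "A \<in> tensor_QS"
    by (intro swap_imp_tensor_QS) (auto simp: qpsd_iff A_def intro: swap)
  moreover have "qform (transpose A) v
      = (\<Sum>a<M. \<Sum>i<L. \<Sum>b<M. \<Sum>j<L. qcnj (V a i) * F b j a i * V b j)"
  proof -
    have "qform (transpose A) v = (\<Sum>p\<in>UNIV. \<Sum>q\<in>UNIV. qcnj (V (c (fst p)) (d (snd p)))
        * F (c (fst q)) (d (snd q)) (c (fst p)) (d (snd p)) * V (c (fst q)) (d (snd q)))"
      by (simp add: qform_def A_def v_def transpose_def)
    also have "\<dots> = (\<Sum>p\<in>UNIV. \<Sum>b<M. \<Sum>j<L. qcnj (V (c (fst p)) (d (snd p)))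
        * F b j (c (fst p)) (d (snd p)) * V b j)"
      by (intro sum.cong[OF refl] sum2) (simp add: V)
    also have "\<dots> = (\<Sum>a<M. \<Sum>i<L. \<Sum>b<M. \<Sum>j<L. qcnj (V a i) * F b j a i * V b j)"
      by (rule sum2) (simp add: V)
    finally show ?thesis .
  qed
  hence "\<not> qpsd (transpose A)"
    using neg unfolding qpsd_iff by (metis not_less qRe_of_real)
  ultimately show ?thesis using psd by blast
qed

lemma quat_literal_simps:
  "Quat a b c d + Quat a' b' c' d' = Quat (a + a') (b + b') (c + c') (d + d')"
  "Quat a b c d * Quat a' b' c' d' = Quat
     (a * a' - b * b' - c * c' - d * d') (a * b' + b * a' + c * d' - d * c')
     (a * c' - b * d' + c * a' + d * b') (a * d' + b * c' - c * b' + d * a')"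
  "qcnj (Quat a b c d) = Quat a (- b) (- c) (- d)"
  "(0 = Quat a b c d) = (0 = a \<and> 0 = b \<and> 0 = c \<and> 0 = d)"
  "(Quat a b c d = 0) = (a = 0 \<and> b = 0 \<and> c = 0 \<and> d = 0)"
  "1 = Quat 1 0 0 0"
  by (auto simp: quat_defs)

lemma counterexample_3_1:
  assumes "3 \<le> CARD('m::finite)"
  shows "\<exists>A :: quat^('m \<times> 'n::finite)^('m \<times> 'n). A \<in> tensor_QS \<and> qpsd A \<and> \<not> qpsd (transpose A)"
proof -
  \<comment> \<open>With g = (1, i, j) as both Gram vector and test vector, the form of the
    transpose is the sum of (g_a* g_b)^2. The three diagonal terms are 1 and the six others -1,
    giving -3.\<close>
  define V :: "nat \<Rightarrow> nat \<Rightarrow> quat" where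
    "V a i = (if i = 0 \<and> a < 3 then [1, Quat 0 1 0 0, Quat 0 0 1 0] ! a else 0)" for a i
  show ?thesis
    by (rule counterexample_from_coordinates[where M = 3 and L = 1 and N = 1 and V = V
          and G = "\<lambda>_. V" and F = "\<lambda>a i b j. V a i * qcnj (V b j)"])
      (use assms in \<open>auto simp: V_def eval_nat_numeral quat_literal_simps\<close>)
qed

lemma counterexample_2_3:
  assumes "2 \<le> CARD('m::finite)" "3 \<le> CARD('n::finite)"
  shows "\<exists>A :: quat^('m \<times> 'n)^('m \<times> 'n). A \<in> tensor_QS \<and> qpsd A \<and> \<not> qpsd (transpose A)"
proof -
  \<comment> \<open>Gram vectors: the rows of \<open>(I, Q)\<close>, conjugated, and two vectors whose Gram matrix is
    \<open>R - Q\<^sup>* Q\<close>. The vector \<open>V\<close> has the form \<open>(- Q\<^sup>* w, w)\<close>, which for the transpose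
    reduces the quadratic form to that of \<open>R - Q Q\<^sup>*\<close> at \<open>w\<close>.\<close>
  define G :: "nat \<Rightarrow> nat \<Rightarrow> nat \<Rightarrow> quat" where
    "G k a i = (if a < 2 \<and> i < 3 then
       [[[1, 0, 0], [0, 1, Quat 0 (-1) 0 0]],
        [[0, 1, 0], [1, 0, Quat 0 0 (-1) 0]],
        [[0, 0, 1], [Quat 0 (-1) 0 0, Quat 0 0 (-1) 0, Quat 0 0 0 (-1)]],
        [[0, 0, 0], [Quat 0 0 0 1, 1, 0]],
        [[0, 0, 0], [Quat 0 0 (-2) 0, 0, 1]]] ! k ! a ! i else 0)" for k a i
  define V :: "nat \<Rightarrow> nat \<Rightarrow> quat" where
    "V a i = (if a < 2 \<and> i < 3 then
       [[Quat (-2) 0 0 0, Quat 0 0 0 (-1), Quat 0 0 2 0], [0, 1, Quat 0 1 0 0]] ! a ! i else 0)" for a i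
  define F where "F a i b j = (\<Sum>k<5. G k a i * qcnj (G k b j))" for a i b j
  \<comment> \<open>Within range this is the symmetry of the blocks I, Q, Q* and R; otherwise both
    sides vanish.\<close>
  have swap: "F a i b j = F a j b i" for a i b j
  proof (cases "a < 2 \<and> b < 2 \<and> i < 3 \<and> j < 3")
    case True
    hence "a \<in> {0, 1}" "b \<in> {0, 1}" "i \<in> {0, 1, 2}" "j \<in> {0, 1, 2}" by auto
    thus ?thesis
      by (auto simp: F_def G_def eval_nat_numeral quat_literal_simps)
  qed (auto simp: F_def G_def)
  \<comment> \<open>On the last two coordinates R - Q Q* is [[1, 2i], [-2i, 1]], with eigenvector
    (1, i) for the eigenvalue -1. Thus w = (0, 1, i) gives the value -2.\<close>
  have "qRe (\<Sum>a<2. \<Sum>i<3. \<Sum>b<2. \<Sum>j<3. qcnj (V a i) * F b j a i * V b j) < 0"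
    by (simp add: F_def G_def V_def eval_nat_numeral quat_literal_simps)
  moreover have "V a i = 0" if "a \<ge> 2 \<or> i \<ge> 3" for a i
    using that by (auto simp: V_def)
  ultimately show ?thesis
    by (intro counterexample_from_coordinates[OF assms F_def swap])
qed

theorem mainTheorem4:
  shows "(\<forall>A :: quat^('m::finite \<times> 'n::finite)^('m \<times> 'n).
            A \<in> tensor_QS \<longrightarrow> qpsd A \<longrightarrow> qpsd (transpose A))
         \<longleftrightarrow> CARD('m) = 1 \<or> (CARD('m) = 2 \<and> CARD('n) \<le> 2)"
proof
  assume preserved: "\<forall>A :: quat^('m \<times> 'n)^('m \<times> 'n).
    A \<in> tensor_QS \<longrightarrow> qpsd A \<longrightarrow> qpsd (transpose A)"
  hence "\<not> 3 \<le> CARD('m)" "\<not> (2 \<le> CARD('m) \<and> 3 \<le> CARD('n))"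
    using counterexample_3_1[where 'm = 'm and 'n = 'n]
      counterexample_2_3[where 'm = 'm and 'n = 'n] by blast+
  moreover have "CARD('m) > 0" by simp
  ultimately show "CARD('m) = 1 \<or> (CARD('m) = 2 \<and> CARD('n) \<le> 2)" by linarith
next
  assume "CARD('m) = 1 \<or> (CARD('m) = 2 \<and> CARD('n) \<le> 2)"
  thus "\<forall>A :: quat^('m \<times> 'n)^('m \<times> 'n). A \<in> tensor_QS \<longrightarrow> qpsd A \<longrightarrow> qpsd (transpose A)"
    using transpose_eq_self_1 qpsd_transpose_2_2 by metis
qed

end
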